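(* Let $a,b\in\mathbb R$, $c\in\mathbb R\setminus\{0,-1,-2,\dots\}$, and let $z=x+iy$ with $x,y\in\mathbb R\setminus\{0\}$. Assume that $|z|<1$, or that $|z|=1$ and $c-a-b>0$. Then $$\operatorname{Re}\,{}_2F_1(a,b;c;z) = \sum_{k\ge0}\frac{(a)_k(b)_k}{(c)_k\,k!}\Big(\frac{|z|^2}{x}\Big)^k\,{}_2F_1\Big(\frac k2,\frac{k+1}2;\frac12;-\frac{y^2}{x^2}\Big),$$ $$\operatorname{Im}\,{}_2F_1(a,b;c;z) = y\,\frac{|z|^2}{x^2}\,\frac{ab}{c}\sum_{k\ge0}\frac{(a+1)_k(b+1)_k}{(c+1)_k\,k!}\Big(\frac{|z|^2}{x}\Big)^k\,{}_2F_1\Big(\frac{k+2}2,\frac{k+3}2;\frac32;-\frac{y^2}{x^2}\Big).$$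
   Context: $(\lambda)_k=\lambda(\lambda+1)\cdots(\lambda+k-1)$, $(\lambda)_0=1$, is the Pochhammer symbol, and ${}_2F_1$ is the Gauss hypergeometric function ${}_2F_1(a,b;c;z)=\sum_{n\ge0}\frac{(a)_n(b)_n}{(c)_n}\frac{z^n}{n!}$; outside the domain of convergence of this series it is defined by analytic continuation (principal branch, cut along $[1,\infty)$). *)

theory Defs
  imports "HOL-Complex_Analysis.Complex_Analysis"
begin

abbreviation hyp2F1_fps :: "complex \<Rightarrow> complex \<Rightarrow> complex \<Rightarrow> complex fps" where
  "hyp2F1_fps a b c \<equiv> fps_hypergeo [a, b] [c] 1"

lemma hyp2F1_fps_nth:
  "fps_nth (hyp2F1_fps a b c) n = pochhammer a n * pochhammer b n / (pochhammer c n * fact n)"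
  by simp

text \<open>
  Where the Gauss series converges (which, depending on the parameters, may include points with
  \<open>norm z = 1\<close>, and is the whole plane if \<open>a\<close> or \<open>b\<close> is a nonpositive integer), the function is its
  sum; by Abel's theorem this agrees with the principal branch at points of the unit circle off the
  cut. Elsewhere it is the value at \<open>z\<close> of the holomorphic extension to the plane cut along the real
  half-line from 1 to infinity, unique by the lemma below. On the cut itself nothing is specified
  where the series diverges.
\<close>

definition hyp2F1 :: "complex \<Rightarrow> complex \<Rightarrow> complex \<Rightarrow> complex \<Rightarrow> complex" where
  "hyp2F1 a b c z =
     (if summable (\<lambda>n. fps_nth (hyp2F1_fps a b c) n * z ^ n)
      then eval_fps (hyp2F1_fps a b c) z
      else (THE w. \<exists>f. f holomorphic_on (- complex_of_real ` {1..}) \<and>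
                       (\<forall>u\<in>ball 0 1. f u = eval_fps (hyp2F1_fps a b c) u) \<and> w = f z))"

lemma hyp2F1_eq_continuation:
  assumes f: "f holomorphic_on (- complex_of_real ` {1..})"
    and f_eq: "\<And>u. u \<in> ball 0 1 \<Longrightarrow> f u = eval_fps (hyp2F1_fps a b c) u"
    and z: "z \<in> - complex_of_real ` {1..}"
    and div: "\<not> summable (\<lambda>n. fps_nth (hyp2F1_fps a b c) n * z ^ n)"
  shows "hyp2F1 a b c z = f z"
proof -
  have "closed (complex_of_real ` {1..})"
    by (intro closed_injective_linear_image) (auto intro!: bounded_linear.linear bounded_linear_of_real inj_onI)
  hence op: "open (- complex_of_real ` {1..})"
    by (simp add: open_Compl)
  have con: "connected (- complex_of_real ` {1..})"
    by (intro starlike_imp_connected starlike_slotted_complex_plane_right)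
  have sub: "ball 0 1 \<subseteq> - complex_of_real ` {1..}"
    by auto
  have "g z = f z"
    if "g holomorphic_on (- complex_of_real ` {1..})"
       "\<forall>u\<in>ball 0 1. g u = eval_fps (hyp2F1_fps a b c) u" for g
    by (rule analytic_continuation_open[OF _ op _ con sub that(1) f _ z]) (use that f_eq in auto)
  hence "(THE w. \<exists>f. f holomorphic_on (- complex_of_real ` {1..}) \<and>
                  (\<forall>u\<in>ball 0 1. f u = eval_fps (hyp2F1_fps a b c) u) \<and> w = f z) = f z"
    using f f_eq by (intro the_equality) blast+
  thus ?thesis
    using div by (simp add: hyp2F1_def)
qed

end

theory Submission
  imports Defs
begin

text \<open>
  On the slit plane the two inner hypergeometric functions are elementary. The numbers
  \<open>(k)\<^sub>n / n!\<close> are the coefficients of \<open>(1 - s)\<^bsup>-k\<^esup>\<close>, and the duplication formula for the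
  Pochhammer symbol turns the even-indexed ones into the coefficients of
  \<open>F(k/2, (k+1)/2; 1/2; s\<^sup>2)\<close> and the odd-indexed ones into those of
  \<open>m s F((m+1)/2, (m+2)/2; 3/2; s\<^sup>2)\<close> for \<open>k = m\<close>. So the first function is the even part of
  \<open>(1 - s)\<^bsup>-k\<^esup>\<close> and the second is, up to the factor \<open>m s\<close>, the odd part of
  \<open>(1 - s)\<^bsup>-m\<^esup>\<close>. Both are rational functions of \<open>s\<^sup>2\<close> without poles outside 1, hence
  they are also the analytic continuations; as the coefficients stay bounded away from 0 (for \<open>k > 0\<close>), the series
  diverges outside the open unit disc, where the continuation therefore gives the value
  (lemmas \<open>hyp2F1_half_even_part\<close> and \<open>hyp2F1_half_odd_part\<close>).

  For \<open>s = \<i> y / x\<close> one has \<open>1 - s = cnj z / x\<close>, \<open>1 + s = z / x\<close> and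
  \<open>\<bar>z\<bar>\<^sup>2 = z * cnj z\<close>. Hence \<open>(\<bar>z\<bar>\<^sup>2 / x)\<^sup>k\<close> times the first function is \<open>Re (z\<^sup>k)\<close>, and the
  second one likewise gives a multiple of \<open>Im (z\<^bsup>k+1\<^esup>)\<close>. The two expansions are thus the real
  and imaginary parts of the Gauss series, taken term by term. Under the hypothesis on \<open>z\<close> this series
  converges, by the ratio of consecutive coefficients inside the disc and by Raabe's test on the
  circle (lemma \<open>summable_pochhammer_ratio_powser\<close>).
\<close>

section \<open>Even and odd parts of a power of \<open>1 / (1 - s)\<close>\<close>

lemma sums_one_minus_inverse_power:
  fixes s :: complex
  assumes "norm s < 1"
  shows "(\<lambda>n. pochhammer (of_nat k) n / fact n * s ^ n) sums (1 / (1 - s) ^ k)"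
proof -
  have "s \<noteq> 1" using assms by auto
  have "(\<lambda>n. (- of_nat k gchoose n) * (- s) ^ n) sums (1 + - s) powr (- of_nat k)"
    using assms by (intro gen_binomial_complex) simp
  also have "(1 + - s) powr (- of_nat k) = 1 / (1 - s) ^ k"
    using \<open>s \<noteq> 1\<close> by (simp add: powr_minus powr_nat field_simps)
  also have "(\<lambda>n. (- of_nat k gchoose n) * (- s) ^ n) = (\<lambda>n. pochhammer (of_nat k) n / fact n * s ^ n)"
    by (intro ext) (simp add: gbinomial_pochhammer flip: power_mult_distrib)
  finally show ?thesis .
qed

lemma sums_even_part:
  fixes s :: "'a :: real_normed_field"
  assumes "(\<lambda>n. f n * s ^ n) sums F" "(\<lambda>n. f n * (- s) ^ n) sums G"
  shows "(\<lambda>n. f (2 * n) * (s\<^sup>2) ^ n) sums ((F + G) / 2)"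
proof -
  have "(\<lambda>n. (f n * s ^ n + f n * (- s) ^ n) / 2) sums ((F + G) / 2)"
    by (intro sums_divide sums_add assms)
  hence "(\<lambda>n. (f (2 * n) * s ^ (2 * n) + f (2 * n) * (- s) ^ (2 * n)) / 2) sums ((F + G) / 2)"
  proof (subst sums_mono_reindex[of "\<lambda>n. 2 * n"])
    fix n :: nat assume "n \<notin> range (\<lambda>n. 2 * n)"
    hence "odd n" by (auto elim: evenE)
    thus "(f n * s ^ n + f n * (- s) ^ n) / 2 = 0" by simp
  qed (simp_all add: strict_mono_def)
  thus ?thesis by (simp add: power_mult)
qed

lemma sums_odd_part:
  fixes s :: "'a :: real_normed_field"
  assumes "(\<lambda>n. f n * s ^ n) sums F" "(\<lambda>n. f n * (- s) ^ n) sums G"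
  shows "(\<lambda>n. f (2 * n + 1) * s * (s\<^sup>2) ^ n) sums ((F - G) / 2)"
proof -
  have "(\<lambda>n. (f n * s ^ n - f n * (- s) ^ n) / 2) sums ((F - G) / 2)"
    by (intro sums_divide sums_diff assms)
  hence "(\<lambda>n. (f (2 * n + 1) * s ^ (2 * n + 1) - f (2 * n + 1) * (- s) ^ (2 * n + 1)) / 2)
           sums ((F - G) / 2)"
  proof (subst sums_mono_reindex[of "\<lambda>n. 2 * n + 1"])
    fix n :: nat assume "n \<notin> range (\<lambda>n. 2 * n + 1)"
    hence "even n" by (metis oddE rangeI)
    thus "(f n * s ^ n - f n * (- s) ^ n) / 2 = 0" by simp
  qed (simp_all add: strict_mono_def)
  moreover have "(f (2 * n + 1) * s ^ (2 * n + 1) - f (2 * n + 1) * (- s) ^ (2 * n + 1)) / 2 =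
                   f (2 * n + 1) * s * (s\<^sup>2) ^ n" for n
  proof -
    have "s ^ (2 * n + 1) = s * (s\<^sup>2) ^ n" "(- s) ^ (2 * n + 1) = - (s * (s\<^sup>2) ^ n)"
      by (simp_all add: power_mult)
    thus ?thesis by (simp only:) simp
  qed
  ultimately show ?thesis by (simp only:)
qed

text \<open>
  The even and odd parts as polynomials in \<open>s\<^sup>2\<close>: this is what makes the closed forms below rational
  in \<open>s\<^sup>2\<close>, hence free of a branch of the square root. The value of \<open>q\<close> at 0 settles
  the removable singularity of the odd part divided by \<open>s\<close>.
\<close>

lemma one_plus_power_even_odd_polys:
  obtains p q :: "complex poly"
  where "\<And>s. (1 + s) ^ k = poly p (s\<^sup>2) + s * poly q (s\<^sup>2)" "poly q 0 = of_nat k"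
proof -
  have "\<exists>p q :: complex poly. (\<forall>s. (1 + s) ^ k = poly p (s\<^sup>2) + s * poly q (s\<^sup>2)) \<and>
          poly p 0 = 1 \<and> poly q 0 = of_nat k"
  proof (induction k)
    case 0
    show ?case by (rule exI[of _ 1], rule exI[of _ 0]) simp
  next
    case (Suc k)
    then obtain p q :: "complex poly" where pq:
      "\<And>s. (1 + s) ^ k = poly p (s\<^sup>2) + s * poly q (s\<^sup>2)" "poly p 0 = 1" "poly q 0 = of_nat k"
      by blast
    have "(1 + s) ^ Suc k = poly (p + pCons 0 q) (s\<^sup>2) + s * poly (p + q) (s\<^sup>2)" for s
      unfolding power_Suc pq(1) by (simp add: algebra_simps power2_eq_square)
    moreover have "poly (p + pCons 0 q) 0 = 1" "poly (p + q) 0 = of_nat (Suc k)"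
      by (simp_all add: pq)
    ultimately show ?case by blast
  qed
  thus ?thesis using that by blast
qed

section \<open>The inner hypergeometric functions in closed form\<close>

lemma hyp2F1_fps_half_even_nth:
  "fps_nth (hyp2F1_fps (a / 2) ((a + 1) / 2) (1 / 2)) n = pochhammer a (2 * n) / fact (2 * n)"
  using pochhammer_double[of "a / 2" n]
  by (simp add: fact_double hyp2F1_fps_nth add_divide_distrib)

lemma hyp2F1_fps_half_odd_nth:
  "fps_nth (hyp2F1_fps ((a + 1) / 2) ((a + 2) / 2) (3 / 2)) n =
     pochhammer (a + 1) (2 * n) / fact (2 * n + 1)"
proof -
  have "(1 / 2) * pochhammer (3 / 2) n = pochhammer (1 / 2 :: complex) n * (1 / 2 + of_nat n)"
    using pochhammer_rec[of "1 / 2 :: complex" n] by (simp add: pochhammer_Suc)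
  hence "(pochhammer (3 / 2) n :: complex) = (2 * of_nat n + 1) * pochhammer (1 / 2) n"
    by (simp add: field_simps)
  moreover have "fact (2 * n + 1) = (2 * of_nat n + 1) * (fact (2 * n) :: complex)"
    by (simp add: algebra_simps)
  moreover have "pochhammer (a + 1) (2 * n) = of_nat (2 ^ (2 * n)) * pochhammer ((a + 1) / 2) n *
      pochhammer ((a + 2) / 2) n"
    using pochhammer_double[of "(a + 1) / 2" n] by (simp add: add_divide_distrib add_ac)
  ultimately show ?thesis
    by (simp add: fact_double hyp2F1_fps_nth)
qed

lemma not_summable_powser_outside_disc:
  fixes f :: "nat \<Rightarrow> complex"
  assumes "\<And>n. norm (f n) \<ge> e" "e > 0" "norm z \<ge> 1"
  shows "\<not> summable (\<lambda>n. f n * z ^ n)"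
proof
  assume "summable (\<lambda>n. f n * z ^ n)"
  hence "(\<lambda>n. norm (f n * z ^ n)) \<longlonglongrightarrow> 0"
    by (intro tendsto_norm_zero summable_LIMSEQ_zero)
  moreover have "norm (f n * z ^ n) \<ge> e" for n
  proof -
    have "e * 1 \<le> norm (f n) * norm z ^ n"
      using assms by (intro mult_mono one_le_power) auto
    thus ?thesis by (simp add: norm_mult norm_power)
  qed
  ultimately have "e \<le> 0" by (intro LIMSEQ_le_const) auto
  with assms(2) show False by simp
qed

lemma norm_pochhammer_of_nat_ge_fact:
  assumes "k > 0"
  shows "norm (pochhammer (of_nat k :: complex) n) \<ge> fact n"
proof -
  have "fact n = pochhammer 1 n" by (simp add: pochhammer_fact)
  also have "\<dots> \<le> pochhammer k n"
    unfolding pochhammer_prod using assms by (intro prod_mono) auto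
  finally have "real (fact n) \<le> real (pochhammer k n)"
    by (simp only: of_nat_le_iff)
  thus ?thesis unfolding pochhammer_of_nat by simp
qed

text \<open>
  The lower bound \<open>e\<close> on the coefficients makes the series diverge outside the open disc. So no point
  there takes its value from a convergent series, for which agreement with the continuation would need
  a separate argument.
\<close>

lemma hyp2F1_eqI:
  assumes "f holomorphic_on (- complex_of_real ` {1..})"
    and f_eq: "\<And>u. norm u < 1 \<Longrightarrow> (\<lambda>n. fps_nth (hyp2F1_fps a b c) n * u ^ n) sums f u"
    and "z \<notin> complex_of_real ` {1..}"
    and "\<And>n. norm (fps_nth (hyp2F1_fps a b c) n) \<ge> e" "e > 0"
  shows "hyp2F1 a b c z = f z"
proof (cases "norm z < 1")
  case True
  show ?thesis
    using f_eq[OF True] unfolding hyp2F1_def eval_fps_def sums_iff by simp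
next
  case False
  show ?thesis
  proof (rule hyp2F1_eq_continuation)
    show "\<not> summable (\<lambda>n. fps_nth (hyp2F1_fps a b c) n * z ^ n)"
      using assms(4,5) False by (intro not_summable_powser_outside_disc) auto
    show "f u = eval_fps (hyp2F1_fps a b c) u" if "u \<in> ball 0 1" for u
      using f_eq[of u] that unfolding eval_fps_def sums_iff by simp
  qed (use assms in auto)
qed

text \<open>
  Here \<open>s\<close> is arbitrary, not the principal square root: the right-hand side is unchanged under
  \<open>s \<mapsto> -s\<close>. In the proof, \<open>p(u) / (1 - u)\<^bsup>k\<^esup>\<close> where \<open>u = s\<^sup>2\<close> and \<open>p(s\<^sup>2)\<close> is the even part
  of \<open>(1 + s)\<^bsup>k\<^esup>\<close>, is the right-hand side over the common denominator.
\<close>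

lemma hyp2F1_half_even_part:
  assumes s: "s\<^sup>2 \<notin> complex_of_real ` {1..}"
  shows "hyp2F1 (of_nat k / 2) ((of_nat k + 1) / 2) (1 / 2) (s\<^sup>2) =
           (1 / (1 - s) ^ k + 1 / (1 + s) ^ k) / 2"
proof (cases "k = 0")
  \<comment> \<open>The series reduces to its constant term, so it converges also outside the disc.\<close>
  case True
  have "(\<lambda>n. fps_nth (hyp2F1_fps 0 (1 / 2) (1 / 2)) n * (s\<^sup>2) ^ n) = (\<lambda>n. if n = 0 then 1 else 0)"
    by (auto simp: hyp2F1_fps_nth fun_eq_iff pochhammer_0_left)
  moreover have "(\<lambda>n. if n = 0 then 1 else 0 :: complex) sums 1"
    using sums_single[of 0 "\<lambda>_. 1 :: complex"] by simp
  ultimately have "hyp2F1 0 (1 / 2) (1 / 2) (s\<^sup>2) = 1"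
    unfolding hyp2F1_def eval_fps_def sums_iff by simp
  thus ?thesis using True by simp
next
  case False
  obtain p q :: "complex poly" where
    pq: "\<And>s. (1 + s) ^ k = poly p (s\<^sup>2) + s * poly q (s\<^sup>2)"
    by (rule one_plus_power_even_odd_polys[of k]) blast
  define f where "f = (\<lambda>u. poly p u / (1 - u) ^ k)"
  have f_sq: "f (t\<^sup>2) = (1 / (1 - t) ^ k + 1 / (1 + t) ^ k) / 2" if "t\<^sup>2 \<noteq> 1" for t
  proof -
    have nz: "1 - t \<noteq> 0" "1 + t \<noteq> 0"
      using that by (auto simp: add_eq_0_iff)
    have p: "poly p (t\<^sup>2) = ((1 + t) ^ k + (1 - t) ^ k) / 2"
      using pq[of t] pq[of "- t"] by simp
    have "1 - t\<^sup>2 = (1 + t) * (1 - t)"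
      by (simp add: algebra_simps power2_eq_square)
    hence "(1 - t\<^sup>2) ^ k = (1 + t) ^ k * (1 - t) ^ k"
      by (simp only: power_mult_distrib)
    thus ?thesis
      using nz unfolding f_def p by (simp add: divide_simps)
  qed
  have "hyp2F1 (of_nat k / 2) ((of_nat k + 1) / 2) (1 / 2) (s\<^sup>2) = f (s\<^sup>2)"
  proof (rule hyp2F1_eqI)
    have "u \<noteq> 1" if "u \<in> - complex_of_real ` {1..}" for u
      using that by force
    thus "f holomorphic_on - complex_of_real ` {1..}"
      unfolding f_def by (intro holomorphic_intros) auto
    show "s\<^sup>2 \<notin> complex_of_real ` {1..}" by (fact s)
    show "1 \<le> norm (fps_nth (hyp2F1_fps (of_nat k / 2) ((of_nat k + 1) / 2) (1 / 2)) n)" for n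
      unfolding hyp2F1_fps_half_even_nth
      using norm_pochhammer_of_nat_ge_fact[of k "2 * n"] False by (simp add: norm_divide)
    show "(\<lambda>n. fps_nth (hyp2F1_fps (of_nat k / 2) ((of_nat k + 1) / 2) (1 / 2)) n * u ^ n) sums f u"
      if "norm u < 1" for u
    proof -
      define t where "t = csqrt u"
      have u: "u = t\<^sup>2" by (simp add: t_def)
      have t: "norm t < 1" using that unfolding u norm_power by (simp add: power_less_one_iff)
      have "u \<noteq> 1" using that by auto
      have "(\<lambda>n. pochhammer (of_nat k) (2 * n) / fact (2 * n) * (t\<^sup>2) ^ n) sums
              ((1 / (1 - t) ^ k + 1 / (1 + t) ^ k) / 2)"
        using sums_even_part[OF sums_one_minus_inverse_power[of t k]
            sums_one_minus_inverse_power[of "- t" k]] t by simp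
      also have "(1 / (1 - t) ^ k + 1 / (1 + t) ^ k) / 2 = f (t\<^sup>2)"
        using f_sq[of t] \<open>u \<noteq> 1\<close> u by simp
      finally show ?thesis
        unfolding hyp2F1_fps_half_even_nth u .
    qed
  qed simp
  also have "s\<^sup>2 \<noteq> 1" using s by force
  ultimately show ?thesis using f_sq[of s] by simp
qed

lemma hyp2F1_half_odd_part:
  assumes s: "s\<^sup>2 \<notin> complex_of_real ` {1..}" "s \<noteq> 0" and m: "m > 0"
  shows "hyp2F1 ((of_nat m + 1) / 2) ((of_nat m + 2) / 2) (3 / 2) (s\<^sup>2) =
           (1 / (1 - s) ^ m - 1 / (1 + s) ^ m) / (2 * of_nat m * s)"
proof -
  let ?F = "hyp2F1_fps ((of_nat m + 1) / 2) ((of_nat m + 2) / 2) (3 / 2)"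
  obtain p q :: "complex poly" where
    pq: "\<And>s. (1 + s) ^ m = poly p (s\<^sup>2) + s * poly q (s\<^sup>2)" and q0: "poly q 0 = of_nat m"
    by (rule one_plus_power_even_odd_polys[of m]) blast
  define f where "f = (\<lambda>u. poly q u / (of_nat m * (1 - u) ^ m))"
  have f_sq: "f (t\<^sup>2) = (1 / (1 - t) ^ m - 1 / (1 + t) ^ m) / (2 * of_nat m * t)"
    if "t\<^sup>2 \<noteq> 1" "t \<noteq> 0" for t
  proof -
    have nz: "1 - t \<noteq> 0" "1 + t \<noteq> 0"
      using that by (auto simp: add_eq_0_iff)
    have "2 * t * poly q (t\<^sup>2) = (1 + t) ^ m - (1 - t) ^ m"
      using pq[of t] pq[of "- t"] by simp
    hence "poly q (t\<^sup>2) = ((1 + t) ^ m - (1 - t) ^ m) / (2 * t)"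
      using that by (simp add: field_simps)
    moreover have "1 - t\<^sup>2 = (1 + t) * (1 - t)"
      by (simp add: algebra_simps power2_eq_square)
    hence "(1 - t\<^sup>2) ^ m = (1 + t) ^ m * (1 - t) ^ m"
      by (simp only: power_mult_distrib)
    ultimately show ?thesis
      using nz m that unfolding f_def by (simp add: divide_simps)
  qed
  have coeff: "of_nat m * fps_nth ?F n = pochhammer (of_nat m) (2 * n + 1) / fact (2 * n + 1)" for n
    unfolding hyp2F1_fps_half_odd_nth by (simp add: pochhammer_rec)
  have "hyp2F1 ((of_nat m + 1) / 2) ((of_nat m + 2) / 2) (3 / 2) (s\<^sup>2) = f (s\<^sup>2)"
  proof (rule hyp2F1_eqI)
    have "u \<noteq> 1" if "u \<in> - complex_of_real ` {1..}" for u
      using that by force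
    thus "f holomorphic_on - complex_of_real ` {1..}"
      unfolding f_def using m by (intro holomorphic_intros) auto
    show "s\<^sup>2 \<notin> complex_of_real ` {1..}" by (fact s)
    show "1 / of_nat m \<le> norm (fps_nth ?F n)" for n
    proof -
      have "1 \<le> norm (of_nat m * fps_nth ?F n)"
        unfolding coeff using norm_pochhammer_of_nat_ge_fact[OF m, of "2 * n + 1"]
        by (simp add: norm_divide del: fact_Suc)
      thus ?thesis using m by (simp add: norm_mult field_simps del: fps_hypergeo_nth)
    qed
    show "(\<lambda>n. fps_nth ?F n * u ^ n) sums f u" if "norm u < 1" for u
    proof (cases "u = 0")
      \<comment> \<open>The closed form in \<open>s\<close> is \<open>0 / 0\<close> here; the polynomial \<open>q\<close> still has a value.\<close>
      case True
      have "(\<lambda>n. fps_nth ?F n * 0 ^ n) sums fps_nth ?F 0"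
        by (rule powser_sums_zero)
      also have "fps_nth ?F 0 = f 0"
        using m q0 by (simp add: f_def)
      finally show ?thesis using True by (simp only:)
    next
      case False
      define t where "t = csqrt u"
      have u: "u = t\<^sup>2" by (simp add: t_def)
      have t: "norm t < 1" using that unfolding u norm_power by (simp add: power_less_one_iff)
      have "u \<noteq> 1" "t \<noteq> 0" using that False by (auto simp: u)
      have "(\<lambda>n. pochhammer (of_nat m) (2 * n + 1) / fact (2 * n + 1) * t * (t\<^sup>2) ^ n) sums
              ((1 / (1 - t) ^ m - 1 / (1 + t) ^ m) / 2)"
        using sums_odd_part[OF sums_one_minus_inverse_power[of t m]
            sums_one_minus_inverse_power[of "- t" m]] t by simp
      hence "(\<lambda>n. of_nat m * fps_nth ?F n * t * (t\<^sup>2) ^ n / (of_nat m * t)) sums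
              ((1 / (1 - t) ^ m - 1 / (1 + t) ^ m) / 2 / (of_nat m * t))"
        unfolding coeff by (rule sums_divide)
      also have "(\<lambda>n. of_nat m * fps_nth ?F n * t * (t\<^sup>2) ^ n / (of_nat m * t)) =
                   (\<lambda>n. fps_nth ?F n * (t\<^sup>2) ^ n)"
        using m \<open>t \<noteq> 0\<close> by (simp add: fun_eq_iff del: fps_hypergeo_nth)
      finally show ?thesis
        using f_sq[of t] \<open>u \<noteq> 1\<close> \<open>t \<noteq> 0\<close> unfolding u by (simp add: mult.assoc)
    qed
    show "1 / real m > 0" using m by simp
  qed
  also have "s\<^sup>2 \<noteq> 1" using s by force
  ultimately show ?thesis using f_sq[of s] s by simp
qed

section \<open>Convergence of the Gauss series\<close>

text \<open>
  The quotient of the \<open>n\<close>-th coefficient by the next one is \<open>1 + (c + d - a - b) / n + O(1 / n\<^sup>2)\<close>. Its limit gives the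
  radius of convergence, its second term gives Raabe's condition on the circle.
\<close>

lemma summable_pochhammer_ratio_powser:
  fixes a b c d :: real and z :: complex
  assumes "c \<notin> \<int>\<^sub>\<le>\<^sub>0" "d \<notin> \<int>\<^sub>\<le>\<^sub>0"
    and z: "norm z < 1 \<or> norm z = 1 \<and> c + d - a - b > 1"
  shows "summable (\<lambda>n. of_real (pochhammer a n * pochhammer b n / (pochhammer c n * pochhammer d n)) * z ^ n)"
proof (cases "a \<in> \<int>\<^sub>\<le>\<^sub>0 \<or> b \<in> \<int>\<^sub>\<le>\<^sub>0")
  case True
  then obtain N where "a = - of_nat N \<or> b = - of_nat N"
    by (auto elim!: nonpos_Ints_cases')
  hence "pochhammer a n * pochhammer b n = 0" if "n \<notin> {..N}" for n
    using that by (auto simp: pochhammer_eq_0_iff)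
  thus ?thesis by (intro summable_finite[of "{..N}"]) auto
next
  case False
  define p where "p = (\<lambda>n. pochhammer a n * pochhammer b n / (pochhammer c n * pochhammer d n))"
  have nz: "pochhammer r n \<noteq> 0" "r + of_nat n \<noteq> 0" if "r \<notin> \<int>\<^sub>\<le>\<^sub>0" for r :: real and n
    using that by (auto dest: pochhammer_eq_0_imp_nonpos_Int plus_of_nat_eq_0_imp)
  define q where "q = (\<lambda>n::nat. (c + n) * (d + n) / ((a + n) * (b + n)))"
  have ratio: "p n / p (Suc n) = q n" for n
    using assms(1,2) False by (simp add: p_def q_def pochhammer_Suc nz divide_simps mult_ac)
  have ratio': "\<bar>p n\<bar> / \<bar>p (Suc n)\<bar> = \<bar>q n\<bar>" for n
    by (simp flip: ratio)
  have q_lim: "q \<longlonglongrightarrow> 1"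
    unfolding q_def by real_asymp
  show ?thesis
  proof (cases "norm z < 1")
    case True
    have "(\<lambda>n. \<bar>q n\<bar>) \<longlonglongrightarrow> \<bar>1\<bar>" by (intro tendsto_rabs q_lim)
    hence "conv_radius (\<lambda>n. complex_of_real (p n)) = 1"
      by (intro conv_radius_ratio_limit_nonzero[of _ 1]) (simp_all add: ratio')
    thus ?thesis using True unfolding p_def by (intro summable_in_conv_radius) auto
  next
    case False
    have "eventually (\<lambda>n. q n > 0) sequentially"
      using q_lim by (rule order_tendstoD) simp
    hence ev: "eventually (\<lambda>n. \<bar>p n\<bar> / \<bar>p (Suc n)\<bar> = q n) sequentially"
      by eventually_elim (simp add: ratio')
    have "(\<lambda>n. real n * (q n - 1)) \<longlonglongrightarrow> c + d - a - b"
      unfolding q_def by real_asymp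
    hence "(\<lambda>n. real n * (\<bar>p n\<bar> / \<bar>p (Suc n)\<bar> - 1)) \<longlonglongrightarrow> c + d - a - b"
      by (rule Lim_transform_eventually) (use ev in eventually_elim, simp)
    hence "liminf (\<lambda>n. ereal (real n * (\<bar>p n\<bar> / \<bar>p (Suc n)\<bar> - 1))) = ereal (c + d - a - b)"
      by (intro lim_imp_Liminf) auto
    moreover have "p n \<noteq> 0" for n
      using \<open>\<not> (a \<in> \<int>\<^sub>\<le>\<^sub>0 \<or> b \<in> \<int>\<^sub>\<le>\<^sub>0)\<close> assms(1,2) by (simp add: p_def nz)
    ultimately have "summable (\<lambda>n. \<bar>p n\<bar>)"
      using z False by (intro raabes_test_convergence) auto
    hence "summable (\<lambda>n. norm (of_real (p n) * z ^ n))"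
      using z False by (simp add: norm_mult norm_power)
    thus ?thesis unfolding p_def by (rule summable_norm_cancel)
  qed
qed

section \<open>The real and the imaginary part\<close>

theorem proposition2:
  fixes a b c x y :: real and z :: complex
  assumes "c \<notin> \<int>\<^sub>\<le>\<^sub>0"
    and "z = Complex x y" and "x \<noteq> 0" and "y \<noteq> 0"
    and "cmod z < 1 \<or> (cmod z = 1 \<and> c - a - b > 0)"
  shows "((\<lambda>k. complex_of_real (pochhammer a k * pochhammer b k / (pochhammer c k * fact k)
                 * ((cmod z)\<^sup>2 / x) ^ k)
             * hyp2F1 (of_nat k / 2) ((of_nat k + 1) / 2) (1 / 2) (of_real (- (y\<^sup>2 / x\<^sup>2))))
           sums complex_of_real (Re (hyp2F1 (of_real a) (of_real b) (of_real c) z)))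
       \<and> (\<exists>S. (\<lambda>k. complex_of_real (pochhammer (a + 1) k * pochhammer (b + 1) k
                 / (pochhammer (c + 1) k * fact k) * ((cmod z)\<^sup>2 / x) ^ k)
               * hyp2F1 ((of_nat k + 2) / 2) ((of_nat k + 3) / 2) (3 / 2) (of_real (- (y\<^sup>2 / x\<^sup>2))))
             sums S
           \<and> complex_of_real (Im (hyp2F1 (of_real a) (of_real b) (of_real c) z))
               = complex_of_real (y * ((cmod z)\<^sup>2 / x\<^sup>2) * (a * b / c)) * S)"
proof -
  define s where "s = \<i> * complex_of_real (y / x)"
  define Q where "Q = complex_of_real ((cmod z)\<^sup>2 / x)"
  define A where "A = (\<lambda>k. pochhammer a k * pochhammer b k / (pochhammer c k * fact k))"
  define B where "B = (\<lambda>k. pochhammer (a + 1) k * pochhammer (b + 1) k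
                             / (pochhammer (c + 1) k * fact k))"
  have s_sq: "complex_of_real (- (y\<^sup>2 / x\<^sup>2)) = s\<^sup>2"
    by (simp add: s_def power_mult_distrib power_divide)
  have s: "s\<^sup>2 \<notin> complex_of_real ` {1..}" "s \<noteq> 0"
  proof -
    show "s\<^sup>2 \<notin> complex_of_real ` {1..}"
    proof
      assume "s\<^sup>2 \<in> complex_of_real ` {1..}"
      then obtain r where "- (y\<^sup>2 / x\<^sup>2) = r" "r \<ge> 1"
        unfolding s_sq [symmetric] by (auto simp del: of_real_minus of_real_divide)
      moreover have "y\<^sup>2 / x\<^sup>2 \<ge> 0" by simp
      ultimately show False by linarith
    qed
    show "s \<noteq> 0" using assms by (simp add: s_def)
  qed
  have z_eq: "1 - s = cnj z / x" "1 + s = z / x"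
    using assms by (simp_all add: s_def complex_eq_iff field_simps)
  have "z \<noteq> 0" using assms by (auto simp: complex_eq_iff)
  have zz: "complex_of_real ((cmod z)\<^sup>2) = z * cnj z"
    by (rule complex_norm_square)
  have Q_div: "Q / (1 - s) = z" "Q / (1 + s) = cnj z"
    unfolding Q_def of_real_divide zz z_eq using \<open>z \<noteq> 0\<close> \<open>x \<noteq> 0\<close> by simp_all

  have even: "Q ^ k * hyp2F1 (of_nat k / 2) ((of_nat k + 1) / 2) (1 / 2) (s\<^sup>2) =
                complex_of_real (Re (z ^ k))" for k
  proof -
    have "Q ^ k * hyp2F1 (of_nat k / 2) ((of_nat k + 1) / 2) (1 / 2) (s\<^sup>2) =
            ((Q / (1 - s)) ^ k + (Q / (1 + s)) ^ k) / 2"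
      unfolding hyp2F1_half_even_part[OF s(1)] by (simp add: power_divide ring_distribs add_divide_distrib)
    also have "\<dots> = complex_of_real (Re (z ^ k))"
      unfolding Q_div by (simp add: complex_eq_iff flip: complex_cnj_power)
    finally show ?thesis .
  qed
  have odd: "Q ^ k * hyp2F1 ((of_nat k + 2) / 2) ((of_nat k + 3) / 2) (3 / 2) (s\<^sup>2) =
               complex_of_real (x\<^sup>2 / (y * (cmod z)\<^sup>2) * (Im (z ^ Suc k) / (real k + 1)))" for k
  proof -
    have "Q \<noteq> 0" using \<open>z \<noteq> 0\<close> \<open>x \<noteq> 0\<close> by (simp add: Q_def)
    have "Q ^ k * hyp2F1 ((of_nat k + 2) / 2) ((of_nat k + 3) / 2) (3 / 2) (s\<^sup>2) =
            Q ^ k * ((1 / (1 - s) ^ Suc k - 1 / (1 + s) ^ Suc k) / (2 * of_nat (Suc k) * s))"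
      using hyp2F1_half_odd_part[OF s, of "Suc k"] by (simp add: add_ac)
    also have "\<dots> = Q ^ Suc k * (1 / (1 - s) ^ Suc k - 1 / (1 + s) ^ Suc k)
                      / (Q * (2 * of_nat (Suc k) * s))"
      using \<open>Q \<noteq> 0\<close> by simp
    also have "Q ^ Suc k * (1 / (1 - s) ^ Suc k - 1 / (1 + s) ^ Suc k) =
                 (Q / (1 - s)) ^ Suc k - (Q / (1 + s)) ^ Suc k"
      by (simp only: power_divide) (simp add: right_diff_distrib)
    also have "\<dots> = 2 * \<i> * complex_of_real (Im (z ^ Suc k))"
      unfolding Q_div by (simp add: complex_eq_iff flip: complex_cnj_power del: power_Suc)
    also have "Q * (2 * of_nat (Suc k) * s) =
                 2 * \<i> * complex_of_real ((cmod z)\<^sup>2 * y * (real k + 1) / x\<^sup>2)"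
      by (simp add: Q_def s_def power2_eq_square mult_ac)
    also have "2 * \<i> * complex_of_real (Im (z ^ Suc k)) / \<dots> =
        complex_of_real (Im (z ^ Suc k) / ((cmod z)\<^sup>2 * y * (real k + 1) / x\<^sup>2))"
      unfolding of_real_divide by simp
    also have "Im (z ^ Suc k) / ((cmod z)\<^sup>2 * y * (real k + 1) / x\<^sup>2) =
        x\<^sup>2 / (y * (cmod z)\<^sup>2) * (Im (z ^ Suc k) / (real k + 1))"
      by (simp add: mult_ac del: power_Suc)
    finally show ?thesis .
  qed

  have c1: "c + 1 \<notin> \<int>\<^sub>\<le>\<^sub>0"
    using assms(1) plus_one_in_nonpos_Ints_imp by blast
  have "c \<noteq> 0" using assms(1) by auto
  have A_Suc: "A (Suc k) = a * b / c * (B k / (real k + 1))" for k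
    using \<open>c \<noteq> 0\<close> by (simp add: A_def B_def pochhammer_rec field_simps)
  \<comment> \<open>Convergence is shown for the coefficients \<open>B k / (k + 1)\<close> and passed on to \<open>A\<close>, not conversely:
      for \<open>a * b = 0\<close> the series over \<open>A\<close> terminates and says nothing about the one over \<open>B\<close>.\<close>
  have "B k / (real k + 1) = pochhammer (a + 1) k * pochhammer (b + 1) k
                              / (pochhammer (c + 1) k * pochhammer 2 k)" for k
  proof -
    have "pochhammer 2 k = fact k * (real k + 1)"
      using pochhammer_rec[of "1 :: real" k] by (simp add: algebra_simps flip: pochhammer_fact)
    thus ?thesis by (simp add: B_def)
  qed
  moreover have "summable (\<lambda>k. of_real (pochhammer (a + 1) k * pochhammer (b + 1) k
                              / (pochhammer (c + 1) k * pochhammer 2 k)) * z ^ k)"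
    by (rule summable_pochhammer_ratio_powser) (use assms(5) c1 in auto)
  ultimately have "summable (\<lambda>k. complex_of_real (B k / (real k + 1)) * z ^ k)"
    by simp
  hence B_summable: "summable (\<lambda>k. complex_of_real (B k / (real k + 1)) * z ^ Suc k)"
    using summable_mult[of "\<lambda>k. complex_of_real (B k / (real k + 1)) * z ^ k" z]
    by (simp add: mult_ac)
  have "summable (\<lambda>k. complex_of_real (a * b / c) * (complex_of_real (B k / (real k + 1)) * z ^ Suc k))"
    by (intro summable_mult B_summable)
  hence "summable (\<lambda>k. complex_of_real (A (Suc k)) * z ^ Suc k)"
    unfolding A_Suc by (simp add: mult_ac)
  hence A_summable: "summable (\<lambda>k. complex_of_real (A k) * z ^ k)"
    by (subst (asm) summable_Suc_iff)
  define H where "H = hyp2F1 (of_real a) (of_real b) (of_real c) z"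
  have coeff: "fps_nth (hyp2F1_fps (of_real a) (of_real b) (of_real c)) k = complex_of_real (A k)" for k
    by (simp add: hyp2F1_fps_nth A_def pochhammer_of_real)
  have H_sums: "(\<lambda>k. complex_of_real (A k) * z ^ k) sums H"
    using A_summable unfolding H_def hyp2F1_def eval_fps_def coeff by (simp add: summable_sums)

  have "(\<lambda>k. A k * Re (z ^ k)) sums Re H"
    using sums_Re[OF H_sums] by simp
  hence "(\<lambda>k. complex_of_real (A k * Re (z ^ k))) sums complex_of_real (Re H)"
    by (rule sums_of_real)
  moreover have "complex_of_real (A k * ((cmod z)\<^sup>2 / x) ^ k)
      * hyp2F1 (of_nat k / 2) ((of_nat k + 1) / 2) (1 / 2) (of_real (- (y\<^sup>2 / x\<^sup>2))) =
      complex_of_real (A k * Re (z ^ k))" for k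
    unfolding s_sq of_real_mult of_real_power Q_def[symmetric] mult.assoc even ..
  ultimately have real_part: "(\<lambda>k. complex_of_real (A k * ((cmod z)\<^sup>2 / x) ^ k)
      * hyp2F1 (of_nat k / 2) ((of_nat k + 1) / 2) (1 / 2) (of_real (- (y\<^sup>2 / x\<^sup>2))))
      sums complex_of_real (Re H)"
    by (simp only:)

  define T where "T = (\<Sum>k. B k / (real k + 1) * Im (z ^ Suc k))"
  define S where "S = x\<^sup>2 / (y * (cmod z)\<^sup>2) * T"
  have T_sums: "(\<lambda>k. B k / (real k + 1) * Im (z ^ Suc k)) sums T"
    using summable_Im[OF B_summable] unfolding T_def by (simp add: summable_sums del: power_Suc)
  have "(\<lambda>k. complex_of_real (x\<^sup>2 / (y * (cmod z)\<^sup>2) * (B k / (real k + 1) * Im (z ^ Suc k))))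
          sums complex_of_real S"
    unfolding S_def by (intro sums_of_real sums_mult T_sums)
  moreover have "complex_of_real (B k * ((cmod z)\<^sup>2 / x) ^ k)
      * hyp2F1 ((of_nat k + 2) / 2) ((of_nat k + 3) / 2) (3 / 2) (of_real (- (y\<^sup>2 / x\<^sup>2))) =
      complex_of_real (x\<^sup>2 / (y * (cmod z)\<^sup>2) * (B k / (real k + 1) * Im (z ^ Suc k)))" for k
  proof -
    have "complex_of_real (B k * ((cmod z)\<^sup>2 / x) ^ k)
      * hyp2F1 ((of_nat k + 2) / 2) ((of_nat k + 3) / 2) (3 / 2) (of_real (- (y\<^sup>2 / x\<^sup>2))) =
      complex_of_real (B k) * complex_of_real (x\<^sup>2 / (y * (cmod z)\<^sup>2) * (Im (z ^ Suc k) / (real k + 1)))"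
      unfolding odd[symmetric] by (simp only: s_sq of_real_mult of_real_power Q_def mult.assoc)
    thus ?thesis by (simp add: mult_ac del: power_Suc)
  qed
  ultimately have S_sums: "(\<lambda>k. complex_of_real (B k * ((cmod z)\<^sup>2 / x) ^ k)
      * hyp2F1 ((of_nat k + 2) / 2) ((of_nat k + 3) / 2) (3 / 2) (of_real (- (y\<^sup>2 / x\<^sup>2))))
      sums complex_of_real S"
    by (simp only:)

  have "(\<lambda>k. A (Suc k) * Im (z ^ Suc k)) sums (a * b / c * T)"
    using sums_mult[OF T_sums, of "a * b / c"] unfolding A_Suc by (simp add: mult_ac del: power_Suc)
  moreover have "(\<lambda>k. A k * Im (z ^ k)) sums Im H"
    using sums_Im[OF H_sums] by simp
  hence "(\<lambda>k. A (Suc k) * Im (z ^ Suc k)) sums Im H"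
    by (subst sums_Suc_iff) simp
  ultimately have "Im H = a * b / c * T"
    using sums_unique2 by blast
  also have "T = y * ((cmod z)\<^sup>2 / x\<^sup>2) * S"
    using \<open>x \<noteq> 0\<close> \<open>y \<noteq> 0\<close> \<open>z \<noteq> 0\<close> by (simp add: S_def)
  finally have "complex_of_real (Im H) =
      complex_of_real (y * ((cmod z)\<^sup>2 / x\<^sup>2) * (a * b / c)) * complex_of_real S"
    by (simp add: mult_ac)
  thus ?thesis
    using real_part S_sums unfolding A_def B_def H_def by blast
qed

end
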